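(* Let $S$ be a finite set, let $\Gamma$ be the Coxeter graph of a Coxeter matrix over $S$, and let $A=A_\Gamma$ and $SA=SA_\Gamma$ be the associated Artin group and singular Artin monoid. Let $\hat\Omega$ be the graph with vertex set $\hat\Upsilon=\{\alpha\tau_s\alpha^{-1} : \alpha\in A,\ s\in S\}\subset SA$ in which two distinct vertices $\hat u,\hat v$ are joined by an edge if and only if $\hat u\hat v=\hat v\hat u$ in $SA$, and let $\mathcal M(\hat\Omega)$ be its graph monoid. Then $SA=\mathcal M(\hat\Omega)\rtimes A$, where $A$ acts on $\mathcal M(\hat\Omega)$ by the action induced by conjugation on $\hat\Upsilon$; that is, the natural homomorphism $\mathcal M(\hat\Omega)\rtimes A\to SA$ which sends each $\alpha\in A$ to $\alpha\in SA$ and each generator $\hat u\in\hat\Upsilon$ to $\hat u\in SA$ is an isomorphism of monoids.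
   Context: A Coxeter matrix over a finite set $S$ is a matrix $(m_{s\,t})_{s,t\in S}$ with $m_{s\,s}=1$ for all $s$ and $m_{s\,t}=m_{t\,s}\in\{2,3,4,\dots,+\infty\}$ for $s\ne t$; it is encoded by its Coxeter graph $\Gamma$. For letters $a,b$ and an integer $m\ge 1$, $w(m:a,b)$ denotes the alternating word $\cdots bab$ of length $m$ ending in $b$. The Artin group $A=A_\Gamma$ is the group generated by $\{\sigma_s; s\in S\}$ with relations $w(m_{s\,t}:\sigma_s,\sigma_t)=w(m_{s\,t}:\sigma_t,\sigma_s)$ for $s\neq t$, $m_{s\,t}<+\infty$. The singular Artin monoid $SA=SA_\Gamma$ is the monoid generated by $\{\sigma_s,\sigma_s^{-1},\tau_s; s\in S\}$ with relations: $\sigma_s\sigma_s^{-1}=\sigma_s^{-1}\sigma_s=1$ and $\sigma_s\tau_s=\tau_s\sigma_s$ for $s\in S$; for $s\ne t$ with $m_{s\,t}<+\infty$, $w(m_{s\,t}:\sigma_s,\sigma_t)=w(m_{s\,t}:\sigma_t,\sigma_s)$ and $w(m_{s\,t}-1:\sigma_s,\sigma_t)\,\tau_s=\tau_{s\wedge t}\,w(m_{s\,t}-1:\sigma_s,\sigma_t)$, where $s\wedge t=s$ if $m_{s\,t}$ is even and $s\wedge t=t$ if $m_{s\,t}$ is odd; and $\tau_s\tau_t=\tau_t\tau_s$ for $s\neq t$ with $m_{s\,t}=2$. The homomorphism $A\to SA$, $\sigma_s^{\pm1}\mapsto\sigma_s^{\pm1}$, is injective (it is a section of the epimorphism $\theta:SA\to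 A$, $\sigma_s^{\pm1}\mapsto\sigma_s^{\pm1}$, $\tau_s\mapsto\sigma_s$), so $A$ is regarded as a submonoid of $SA$. For a simple graph $G$ with vertex set $V$ and edge set $E$, the graph monoid is the monoid $\mathcal M(G)=\langle V\mid uv=vu\text{ if }\{u,v\}\in E\rangle^+$. Conjugation by elements of $A$ inside $SA$ permutes $\hat\Upsilon$ and preserves the edges of $\hat\Omega$, hence induces an action of $A$ on $\mathcal M(\hat\Omega)$ by automorphisms. *)

theory Defs
  imports "HOL-Algebra.Group" "HOL-Library.Extended_Nat"
begin

section \<open>Monoid and group presentations\<close>

inductive_set word_cong :: "'a set \<Rightarrow> ('a list \<times> 'a list) set \<Rightarrow> ('a list \<times> 'a list) set"
  for X :: "'a set" and R :: "('a list \<times> 'a list) set" where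
  refl: "w \<in> lists X \<Longrightarrow> (w, w) \<in> word_cong X R"
| rel: "(u, v) \<in> R \<Longrightarrow> u \<in> lists X \<Longrightarrow> v \<in> lists X \<Longrightarrow> x \<in> lists X \<Longrightarrow> y \<in> lists X
    \<Longrightarrow> (x @ u @ y, x @ v @ y) \<in> word_cong X R"
| sym: "(u, v) \<in> word_cong X R \<Longrightarrow> (v, u) \<in> word_cong X R"
| trans: "(u, v) \<in> word_cong X R \<Longrightarrow> (v, w) \<in> word_cong X R \<Longrightarrow> (u, w) \<in> word_cong X R"

definition presented_monoid :: "'a set \<Rightarrow> ('a list \<times> 'a list) set \<Rightarrow> 'a list set monoid" where
  "presented_monoid X R =
    \<lparr>carrier = lists X // word_cong X R,
     mult = (\<lambda>c d. \<Union>u\<in>c. \<Union>v\<in>d. word_cong X R `` {u @ v}),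
     one = word_cong X R `` {[]}\<rparr>"

lemma word_cong_lists: "(u, v) \<in> word_cong X R \<Longrightarrow> u \<in> lists X \<and> v \<in> lists X"
  by (induction rule: word_cong.induct) auto

lemma equiv_word_cong: "equiv (lists X) (word_cong X R)"
proof (rule equivI)
  show "word_cong X R \<subseteq> lists X \<times> lists X"
    by (auto dest: word_cong_lists)
  show "refl_on (lists X) (word_cong X R)"
    by (rule refl_onI) (rule word_cong.refl)
  show "sym (word_cong X R)" by (rule symI) (rule word_cong.sym)
  show "trans (word_cong X R)" by (rule transI) (rule word_cong.trans)
qed

lemma word_cong_context:
  "(u, v) \<in> word_cong X R \<Longrightarrow> x \<in> lists X \<Longrightarrow> y \<in> lists X
    \<Longrightarrow> (x @ u @ y, x @ v @ y) \<in> word_cong X R"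
proof (induction rule: word_cong.induct)
  case (rel u v a b)
  then show ?case
    using word_cong.rel[of u v R X "x @ a" "b @ y"] by auto
next
  case (refl w)
  then show ?case by (intro word_cong.refl) auto
qed (auto intro: word_cong.sym word_cong.trans)

lemma word_cong_append:
  assumes "(u, u') \<in> word_cong X R" "(v, v') \<in> word_cong X R"
  shows "(u @ v, u' @ v') \<in> word_cong X R"
proof -
  have "(u @ v, u' @ v) \<in> word_cong X R"
    using word_cong_context[OF assms(1), of "[]" v] word_cong_lists[OF assms(2)] by simp
  moreover have "(u' @ v, u' @ v') \<in> word_cong X R"
    using word_cong_context[OF assms(2), of u' "[]"] word_cong_lists[OF assms(1)] by simp
  ultimately show ?thesis by (rule word_cong.trans)
qed

lemma class_eqI: "(u, v) \<in> word_cong X R \<Longrightarrow> word_cong X R `` {u} = word_cong X R `` {v}"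
  by (rule equiv_class_eq[OF equiv_word_cong])

lemma presented_monoid_carrier:
  "c \<in> carrier (presented_monoid X R) \<longleftrightarrow> (\<exists>w\<in>lists X. c = word_cong X R `` {w})"
  unfolding presented_monoid_def quotient_def by auto

lemma presented_monoid_one: "\<one>\<^bsub>presented_monoid X R\<^esub> = word_cong X R `` {[]}"
  unfolding presented_monoid_def by simp

lemma presented_monoid_mult:
  assumes "u \<in> lists X" "v \<in> lists X"
  shows "word_cong X R `` {u} \<otimes>\<^bsub>presented_monoid X R\<^esub> word_cong X R `` {v}
    = word_cong X R `` {u @ v}"
proof -
  have *: "word_cong X R `` {a @ b} = word_cong X R `` {u @ v}"
    if "a \<in> word_cong X R `` {u}" "b \<in> word_cong X R `` {v}" for a b
    using that word_cong_append[of u a X R v b] class_eqI by blast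
  have "u \<in> word_cong X R `` {u}" "v \<in> word_cong X R `` {v}"
    using assms by (auto intro: word_cong.refl)
  then have "(\<Union>a\<in>word_cong X R `` {u}. \<Union>b\<in>word_cong X R `` {v}. word_cong X R `` {a @ b})
      = word_cong X R `` {u @ v}"
    using * by blast
  then show ?thesis
    unfolding presented_monoid_def by simp
qed

lemma presented_monoid_monoid: "monoid (presented_monoid X R)"
proof (rule monoidI)
  fix c d e assume "c \<in> carrier (presented_monoid X R)" "d \<in> carrier (presented_monoid X R)"
    "e \<in> carrier (presented_monoid X R)"
  then obtain u v w where w: "u \<in> lists X" "v \<in> lists X" "w \<in> lists X"
    "c = word_cong X R `` {u}" "d = word_cong X R `` {v}" "e = word_cong X R `` {w}"
    unfolding presented_monoid_carrier by blast
  have uv: "u @ v \<in> lists X" "v @ w \<in> lists X" using w by auto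
  show "c \<otimes>\<^bsub>presented_monoid X R\<^esub> d \<otimes>\<^bsub>presented_monoid X R\<^esub> e
      = c \<otimes>\<^bsub>presented_monoid X R\<^esub> (d \<otimes>\<^bsub>presented_monoid X R\<^esub> e)"
    using w uv by (simp add: presented_monoid_mult del: in_lists_conv_set append_in_lists_conv)
next
  fix c d assume "c \<in> carrier (presented_monoid X R)" "d \<in> carrier (presented_monoid X R)"
  then obtain u v where w: "u \<in> lists X" "v \<in> lists X"
    "c = word_cong X R `` {u}" "d = word_cong X R `` {v}"
    unfolding presented_monoid_carrier by blast
  then show "c \<otimes>\<^bsub>presented_monoid X R\<^esub> d \<in> carrier (presented_monoid X R)"
    unfolding presented_monoid_carrier
    by (metis append_in_lists_conv presented_monoid_mult)
next
  show "\<one>\<^bsub>presented_monoid X R\<^esub> \<in> carrier (presented_monoid X R)"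
    unfolding presented_monoid_carrier presented_monoid_one by blast
next
  fix c assume "c \<in> carrier (presented_monoid X R)"
  then obtain u where "u \<in> lists X" "c = word_cong X R `` {u}"
    unfolding presented_monoid_carrier by blast
  then show "\<one>\<^bsub>presented_monoid X R\<^esub> \<otimes>\<^bsub>presented_monoid X R\<^esub> c = c"
    "c \<otimes>\<^bsub>presented_monoid X R\<^esub> \<one>\<^bsub>presented_monoid X R\<^esub> = c"
    by (simp_all add: presented_monoid_one presented_monoid_mult del: in_lists_conv_set)
qed

definition presented_gen :: "'a set \<Rightarrow> ('a list \<times> 'a list) set \<Rightarrow> 'a \<Rightarrow> 'a list set" where
  "presented_gen X R x = word_cong X R `` {[x]}"

definition word_eval :: "('b, 'c) monoid_scheme \<Rightarrow> ('a \<Rightarrow> 'b) \<Rightarrow> 'a list \<Rightarrow> 'b" where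
  "word_eval N f w = foldr (mult N) (map f w) \<one>\<^bsub>N\<^esub>"

text \<open>The homomorphism from a presented monoid to \<open>N\<close> with \<open>x \<mapsto> f x\<close> on generators.
  It is meaningful only if \<open>f\<close> respects the defining relations: all words of a
  class then have the same value (see \<open>presented_lift_class\<close> below).\<close>

definition presented_lift :: "('b, 'c) monoid_scheme \<Rightarrow> ('a \<Rightarrow> 'b) \<Rightarrow> 'a list set \<Rightarrow> 'b" where
  "presented_lift N f c = the_elem (word_eval N f ` c)"

lemma presented_gen_closed:
  "x \<in> X \<Longrightarrow> presented_gen X R x \<in> carrier (presented_monoid X R)"
  unfolding presented_monoid_carrier presented_gen_def by (rule bexI[of _ "[x]"]) auto

lemma word_eval_simps [simp]:
  "word_eval N f [] = \<one>\<^bsub>N\<^esub>" "word_eval N f (x # w) = f x \<otimes>\<^bsub>N\<^esub> word_eval N f w"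
  unfolding word_eval_def by simp_all

lemma word_eval_closed:
  assumes "monoid N" "f \<in> X \<rightarrow> carrier N" "w \<in> lists X"
  shows "word_eval N f w \<in> carrier N"
proof -
  interpret monoid N by fact
  show ?thesis using assms(3,2) by induction auto
qed

lemma word_eval_append:
  assumes "monoid N" "f \<in> X \<rightarrow> carrier N" "u \<in> lists X" "v \<in> lists X"
  shows "word_eval N f (u @ v) = word_eval N f u \<otimes>\<^bsub>N\<^esub> word_eval N f v"
proof -
  interpret monoid N by fact
  have v: "word_eval N f v \<in> carrier N" using word_eval_closed assms by metis
  show ?thesis using assms(3)
  proof induction
    case (Cons a l)
    then have "word_eval N f l \<in> carrier N" "f a \<in> carrier N"
      using word_eval_closed[OF assms(1,2)] assms(2) by auto
    then show ?case using Cons v by (simp add: m_assoc)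
  qed (use v in simp)
qed

lemma word_eval_gens:
  assumes "w \<in> lists X" "g ` X \<subseteq> Y"
  shows "word_eval (presented_monoid Y R) (\<lambda>x. presented_gen Y R (g x)) w
    = word_cong Y R `` {map g w}"
  using assms(1)
proof induction
  case (Cons a l)
  moreover from Cons have "[g a] \<in> lists Y" "map g l \<in> lists Y" using assms(2) by fastforce+
  ultimately show ?case
    by (simp add: presented_gen_def presented_monoid_mult del: in_lists_conv_set)
qed (simp add: presented_monoid_one)

context
  fixes N :: "('b, 'c) monoid_scheme" (structure) and X :: "'a set"
    and R :: "('a list \<times> 'a list) set" and f :: "'a \<Rightarrow> 'b"
  assumes N: "monoid N" and f: "f \<in> X \<rightarrow> carrier N"
    and respects: "\<And>u v. (u, v) \<in> R \<Longrightarrow> u \<in> lists X \<Longrightarrow> v \<in> lists X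
      \<Longrightarrow> word_eval N f u = word_eval N f v"
begin

lemma word_eval_cong: "(u, v) \<in> word_cong X R \<Longrightarrow> word_eval N f u = word_eval N f v"
proof (induction rule: word_cong.induct)
  case (rel u v x y)
  then have "u @ y \<in> lists X" "v @ y \<in> lists X" by auto
  with rel respects[of u v] show ?case
    by (simp add: word_eval_append[OF N f] del: in_lists_conv_set append_in_lists_conv)
qed auto

lemma presented_lift_class:
  assumes "w \<in> lists X"
  shows "presented_lift N f (word_cong X R `` {w}) = word_eval N f w"
proof -
  have "w \<in> word_cong X R `` {w}" using word_cong.refl[OF assms] by blast
  moreover have "word_eval N f v = word_eval N f w" if "v \<in> word_cong X R `` {w}" for v
    using that word_eval_cong[of w v] by simp
  ultimately have "word_eval N f ` (word_cong X R `` {w}) = {word_eval N f w}"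
    by blast
  then show ?thesis unfolding presented_lift_def by simp
qed

lemma presented_lift_gen:
  assumes "x \<in> X" shows "presented_lift N f (presented_gen X R x) = f x"
proof -
  interpret monoid N by (rule N)
  show ?thesis
    using presented_lift_class[of "[x]"] assms funcset_mem[OF f assms]
    unfolding presented_gen_def by simp
qed

lemma presented_lift_one: "presented_lift N f \<one>\<^bsub>presented_monoid X R\<^esub> = \<one>"
  using presented_lift_class[of "[]"] by (simp add: presented_monoid_one)

lemma presented_lift_hom: "presented_lift N f \<in> hom (presented_monoid X R) N"
proof (rule homI)
  fix c assume "c \<in> carrier (presented_monoid X R)"
  then show "presented_lift N f c \<in> carrier N"
    using presented_lift_class word_eval_closed[OF N f]
    unfolding presented_monoid_carrier by force
next
  fix c d assume "c \<in> carrier (presented_monoid X R)" "d \<in> carrier (presented_monoid X R)"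
  then obtain u v where w: "u \<in> lists X" "v \<in> lists X"
    "c = word_cong X R `` {u}" "d = word_cong X R `` {v}"
    unfolding presented_monoid_carrier by blast
  moreover have "u @ v \<in> lists X" using w by auto
  ultimately show "presented_lift N f (c \<otimes>\<^bsub>presented_monoid X R\<^esub> d)
      = presented_lift N f c \<otimes> presented_lift N f d"
    by (simp add: presented_monoid_mult presented_lift_class word_eval_append[OF N f]
        del: in_lists_conv_set append_in_lists_conv)
qed

end

datatype 'a signed = Pos 'a | Neg 'a

text \<open>The group \<open>\<langle>X | R\<rangle>\<close>, as the monoid presented by the letters \<open>x\<close>, \<open>x\<inverse>\<close> with
  the additional relations \<open>x x\<inverse> = x\<inverse> x = 1\<close>.\<close>

definition presented_group ::
  "'a set \<Rightarrow> ('a signed list \<times> 'a signed list) set \<Rightarrow> 'a signed list set monoid" where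
  "presented_group X R = presented_monoid (Pos ` X \<union> Neg ` X)
    (R \<union> {([Pos x, Neg x], []) | x. x \<in> X} \<union> {([Neg x, Pos x], []) | x. x \<in> X})"


lemma presented_group_group: "group (presented_group X R)"
proof -
  define L where "L = Pos ` X \<union> Neg ` X"
  define R' where "R' = R \<union> {([Pos x, Neg x], []) | x. x \<in> X} \<union> {([Neg x, Pos x], []) | x. x \<in> X}"
  have G: "presented_group X R = presented_monoid L R'"
    unfolding presented_group_def L_def R'_def ..
  interpret monoid "presented_monoid L R'" by (rule presented_monoid_monoid)
  have gen: "\<exists>v\<in>lists L. (v @ [a], []) \<in> word_cong L R'" if a: "a \<in> L" for a
  proof -
    have "([Neg x, Pos x], []) \<in> word_cong L R'" "([Pos x, Neg x], []) \<in> word_cong L R'"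
      if "x \<in> X" for x
      using that word_cong.rel[of "[Neg x, Pos x]" "[]" R' L "[]" "[]"]
        word_cong.rel[of "[Pos x, Neg x]" "[]" R' L "[]" "[]"]
      unfolding L_def R'_def by auto
    moreover obtain x where "x \<in> X" "a = Pos x \<or> a = Neg x" using a unfolding L_def by auto
    ultimately show ?thesis
      by (intro bexI[of _ "[if a = Pos x then Neg x else Pos x]"]) (auto simp: L_def)
  qed
  have inv: "\<exists>v\<in>lists L. (v @ w, []) \<in> word_cong L R'" if "w \<in> lists L" for w
    using that
  proof induction
    case Nil
    show ?case by (rule bexI[of _ "[]"]) (auto intro: word_cong.refl)
  next
    case (Cons a l)
    obtain v where v: "v \<in> lists L" "(v @ l, []) \<in> word_cong L R'" using Cons by blast
    obtain b where b: "b \<in> lists L" "(b @ [a], []) \<in> word_cong L R'" using gen Cons by blast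
    have "(v @ (b @ [a]) @ l, v @ [] @ l) \<in> word_cong L R'"
      using b v Cons by (intro word_cong_context) auto
    then have "((v @ b) @ a # l, []) \<in> word_cong L R'"
      using v(2) word_cong.trans by fastforce
    then show ?case using v b by (intro bexI[of _ "v @ b"]) auto
  qed
  show ?thesis unfolding G
  proof (rule groupI)
    fix c assume "c \<in> carrier (presented_monoid L R')"
    then obtain w where w: "w \<in> lists L" "c = word_cong L R' `` {w}"
      unfolding presented_monoid_carrier by blast
    obtain v where v: "v \<in> lists L" "(v @ w, []) \<in> word_cong L R'" using inv w by blast
    show "\<exists>d\<in>carrier (presented_monoid L R').
        d \<otimes>\<^bsub>presented_monoid L R'\<^esub> c = \<one>\<^bsub>presented_monoid L R'\<^esub>"
    proof
      show "word_cong L R' `` {v} \<otimes>\<^bsub>presented_monoid L R'\<^esub> c = \<one>\<^bsub>presented_monoid L R'\<^esub>"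
        unfolding presented_monoid_one w(2) presented_monoid_mult[OF v(1) w(1)]
        by (rule class_eqI[OF v(2)])
      show "word_cong L R' `` {v} \<in> carrier (presented_monoid L R')"
        unfolding presented_monoid_carrier using v(1) by (intro bexI[of _ v]) (rule HOL.refl)
    qed
  qed (auto simp: m_assoc)
qed


section \<open>Coxeter matrices, Artin groups and singular Artin monoids\<close>

text \<open>A Coxeter graph is an encoding of its Coxeter matrix, so everything below is indexed by
  the pair \<open>(S, m)\<close>; only the values of \<open>m\<close> on \<open>S\<close> matter.\<close>

definition coxeter_matrix :: "'s set \<Rightarrow> ('s \<Rightarrow> 's \<Rightarrow> enat) \<Rightarrow> bool" where
  "coxeter_matrix S m \<longleftrightarrow>
    (\<forall>s\<in>S. m s s = 1) \<and> (\<forall>s\<in>S. \<forall>t\<in>S. s \<noteq> t \<longrightarrow> m s t = m t s \<and> 2 \<le> m s t)"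

text \<open>The word \<open>\<cdots>bab\<close> of length \<open>n\<close>, ending in \<open>b\<close>.\<close>

fun alt_word :: "nat \<Rightarrow> 'a \<Rightarrow> 'a \<Rightarrow> 'a list" where
  "alt_word 0 a b = []"
| "alt_word (Suc n) a b = alt_word n b a @ [b]"

definition artin_group :: "'s set \<Rightarrow> ('s \<Rightarrow> 's \<Rightarrow> enat) \<Rightarrow> 's signed list set monoid" where
  "artin_group S m = presented_group S
    {(alt_word k (Pos s) (Pos t), alt_word k (Pos t) (Pos s)) | s t k.
       s \<in> S \<and> t \<in> S \<and> s \<noteq> t \<and> m s t = enat k}"

datatype 's sing_letter = Sig 's | SigInv 's | Tau 's

definition sing_letters :: "'s set \<Rightarrow> 's sing_letter set" where
  "sing_letters S = Sig ` S \<union> SigInv ` S \<union> Tau ` S"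

definition sing_relations ::
  "'s set \<Rightarrow> ('s \<Rightarrow> 's \<Rightarrow> enat) \<Rightarrow> ('s sing_letter list \<times> 's sing_letter list) set" where
  "sing_relations S m =
     {([Sig s, SigInv s], []) | s. s \<in> S}
   \<union> {([SigInv s, Sig s], []) | s. s \<in> S}
   \<union> {([Sig s, Tau s], [Tau s, Sig s]) | s. s \<in> S}
   \<union> {(alt_word k (Sig s) (Sig t), alt_word k (Sig t) (Sig s)) | s t k.
        s \<in> S \<and> t \<in> S \<and> s \<noteq> t \<and> m s t = enat k}
   \<union> {(alt_word (k - 1) (Sig s) (Sig t) @ [Tau s],
       [Tau (if even k then s else t)] @ alt_word (k - 1) (Sig s) (Sig t)) | s t k.
        s \<in> S \<and> t \<in> S \<and> s \<noteq> t \<and> m s t = enat k}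
   \<union> {([Tau s, Tau t], [Tau t, Tau s]) | s t. s \<in> S \<and> t \<in> S \<and> s \<noteq> t \<and> m s t = 2}"

definition singular_artin_monoid ::
  "'s set \<Rightarrow> ('s \<Rightarrow> 's \<Rightarrow> enat) \<Rightarrow> 's sing_letter list set monoid" where
  "singular_artin_monoid S m = presented_monoid (sing_letters S) (sing_relations S m)"

definition sing_gen :: "'s set \<Rightarrow> ('s \<Rightarrow> 's \<Rightarrow> enat) \<Rightarrow> 's sing_letter \<Rightarrow> 's sing_letter list set" where
  "sing_gen S m = presented_gen (sing_letters S) (sing_relations S m)"

text \<open>The homomorphism \<open>A \<rightarrow> SA\<close>, \<open>\<sigma>\<^sub>s \<mapsto> \<sigma>\<^sub>s\<close>, by which \<open>A\<close> is regarded as a submonoid of \<open>SA\<close>.\<close>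

definition artin_incl ::
  "'s set \<Rightarrow> ('s \<Rightarrow> 's \<Rightarrow> enat) \<Rightarrow> 's signed list set \<Rightarrow> 's sing_letter list set" where
  "artin_incl S m = presented_lift (singular_artin_monoid S m)
    (case_signed (\<lambda>s. sing_gen S m (Sig s)) (\<lambda>s. sing_gen S m (SigInv s)))"


lemma artin_group_group: "group (artin_group S m)"
  unfolding artin_group_def by (rule presented_group_group)

lemma singular_artin_monoid_monoid: "monoid (singular_artin_monoid S m)"
  unfolding singular_artin_monoid_def by (rule presented_monoid_monoid)

lemma artin_incl_hom: "artin_incl S m \<in> hom (artin_group S m) (singular_artin_monoid S m)"
  and artin_incl_one: "artin_incl S m \<one>\<^bsub>artin_group S m\<^esub> = \<one>\<^bsub>singular_artin_monoid S m\<^esub>"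
proof -
  define e :: "'a signed \<Rightarrow> 'a sing_letter" where "e = case_signed Sig SigInv"
  define L where "L = Pos ` S \<union> Neg ` S"
  define R where "R = {(alt_word k (Pos s) (Pos t), alt_word k (Pos t) (Pos s)) | s t k.
       s \<in> S \<and> t \<in> S \<and> s \<noteq> t \<and> m s t = enat k}
     \<union> {([Pos x, Neg x], []) | x. x \<in> S} \<union> {([Neg x, Pos x], []) | x. x \<in> S}"
  let ?f = "\<lambda>x. sing_gen S m (e x)"
  have A: "artin_group S m = presented_monoid L R"
    unfolding artin_group_def presented_group_def L_def R_def ..
  have I: "artin_incl S m = presented_lift (singular_artin_monoid S m) ?f"
    unfolding artin_incl_def e_def by (rule arg_cong[of _ _ "presented_lift _"]) (rule ext, simp split: signed.split)
  have e: "e ` L \<subseteq> sing_letters S" unfolding e_def L_def sing_letters_def by auto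
  have f: "?f \<in> L \<rightarrow> carrier (singular_artin_monoid S m)"
    using e unfolding sing_gen_def singular_artin_monoid_def by (auto intro: presented_gen_closed)
  have alt: "map e (alt_word k a b) = alt_word k (e a) (e b)" for k a b
    by (induction k arbitrary: a b) auto
  have "(map e u, map e v) \<in> sing_relations S m" if "(u, v) \<in> R" for u v
  proof -
    consider (braid) s t k where "s \<in> S" "t \<in> S" "s \<noteq> t" "m s t = enat k"
        "u = alt_word k (Pos s) (Pos t)" "v = alt_word k (Pos t) (Pos s)"
      | (inv) s where "s \<in> S" "v = []" "u = [Pos s, Neg s] \<or> u = [Neg s, Pos s]"
      using \<open>(u, v) \<in> R\<close> unfolding R_def by blast
    then show ?thesis
    proof cases
      case braid
      then have "map e u = alt_word k (Sig s) (Sig t)" "map e v = alt_word k (Sig t) (Sig s)"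
        by (simp_all add: alt) (simp_all add: e_def)
      with braid show ?thesis unfolding sing_relations_def by blast
    next
      case inv
      then show ?thesis unfolding sing_relations_def e_def by auto
    qed
  qed
  moreover have map_e: "map e u \<in> lists (sing_letters S)" if "u \<in> lists L" for u
    using that e by fastforce
  ultimately have cong: "(map e u, map e v) \<in> word_cong (sing_letters S) (sing_relations S m)"
    if "(u, v) \<in> R" "u \<in> lists L" "v \<in> lists L" for u v
    using word_cong.rel[of "map e u" "map e v" "sing_relations S m" "sing_letters S" "[]" "[]"]
      that map_e[OF that(2)] map_e[OF that(3)] by simp
  then have resp: "word_eval (singular_artin_monoid S m) ?f u = word_eval (singular_artin_monoid S m) ?f v"
    if "(u, v) \<in> R" "u \<in> lists L" "v \<in> lists L" for u v
    using class_eqI[OF cong[OF that]] word_eval_gens[OF that(2) e] word_eval_gens[OF that(3) e]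
    unfolding singular_artin_monoid_def sing_gen_def by simp
  show "artin_incl S m \<in> hom (artin_group S m) (singular_artin_monoid S m)"
    unfolding A I by (rule presented_lift_hom[OF singular_artin_monoid_monoid f resp])
  show "artin_incl S m \<one>\<^bsub>artin_group S m\<^esub> = \<one>\<^bsub>singular_artin_monoid S m\<^esub>"
    unfolding A I by (rule presented_lift_one[OF singular_artin_monoid_monoid f resp])
qed
lemma artin_incl_closed:
  "\<alpha> \<in> carrier (artin_group S m) \<Longrightarrow> artin_incl S m \<alpha> \<in> carrier (singular_artin_monoid S m)"
  by (rule hom_in_carrier[OF artin_incl_hom])

lemma artin_incl_mult:
  "\<alpha> \<in> carrier (artin_group S m) \<Longrightarrow> \<beta> \<in> carrier (artin_group S m) \<Longrightarrow>
    artin_incl S m (\<alpha> \<otimes>\<^bsub>artin_group S m\<^esub> \<beta>)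
      = artin_incl S m \<alpha> \<otimes>\<^bsub>singular_artin_monoid S m\<^esub> artin_incl S m \<beta>"
  by (rule hom_mult[OF artin_incl_hom])



section \<open>Graph monoids and semidirect products\<close>

definition graph_relations :: "'v set set \<Rightarrow> ('v list \<times> 'v list) set" where
  "graph_relations E = {([u, v], [v, u]) | u v. {u, v} \<in> E}"

definition graph_monoid :: "'v set \<Rightarrow> 'v set set \<Rightarrow> 'v list set monoid" where
  "graph_monoid V E = presented_monoid V (graph_relations E)"

definition graph_gen :: "'v set \<Rightarrow> 'v set set \<Rightarrow> 'v \<Rightarrow> 'v list set" where
  "graph_gen V E = presented_gen V (graph_relations E)"

definition semidirect_product ::
  "('a, 'c) monoid_scheme \<Rightarrow> ('b, 'd) monoid_scheme \<Rightarrow> ('b \<Rightarrow> 'a \<Rightarrow> 'a) \<Rightarrow> ('a \<times> 'b) monoid" where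
  "semidirect_product M G \<phi> =
    \<lparr>carrier = carrier M \<times> carrier G,
     mult = (\<lambda>(u, g) (v, h). (u \<otimes>\<^bsub>M\<^esub> \<phi> g v, g \<otimes>\<^bsub>G\<^esub> h)),
     one = (\<one>\<^bsub>M\<^esub>, \<one>\<^bsub>G\<^esub>)\<rparr>"


section \<open>The graph of conjugates of the singular generators\<close>

definition artin_conj ::
  "'s set \<Rightarrow> ('s \<Rightarrow> 's \<Rightarrow> enat) \<Rightarrow> 's signed list set \<Rightarrow> 's sing_letter list set \<Rightarrow> 's sing_letter list set" where
  "artin_conj S m \<alpha> x =
    artin_incl S m \<alpha> \<otimes>\<^bsub>singular_artin_monoid S m\<^esub> x
      \<otimes>\<^bsub>singular_artin_monoid S m\<^esub> artin_incl S m (inv\<^bsub>artin_group S m\<^esub> \<alpha>)"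

lemma artin_conj_closed:
  assumes "\<alpha> \<in> carrier (artin_group S m)" "x \<in> carrier (singular_artin_monoid S m)"
  shows "artin_conj S m \<alpha> x \<in> carrier (singular_artin_monoid S m)"
proof -
  interpret A: group "artin_group S m" by (rule artin_group_group)
  interpret SA: monoid "singular_artin_monoid S m" by (rule singular_artin_monoid_monoid)
  show ?thesis unfolding artin_conj_def
    using assms by (simp add: artin_incl_closed)
qed

lemma artin_conj_one:
  assumes "x \<in> carrier (singular_artin_monoid S m)"
  shows "artin_conj S m \<one>\<^bsub>artin_group S m\<^esub> x = x"
proof -
  interpret A: group "artin_group S m" by (rule artin_group_group)
  interpret SA: monoid "singular_artin_monoid S m" by (rule singular_artin_monoid_monoid)
  show ?thesis unfolding artin_conj_def using assms by (simp add: artin_incl_one)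
qed

lemma artin_conj_comp:
  assumes "\<alpha> \<in> carrier (artin_group S m)" "\<beta> \<in> carrier (artin_group S m)"
    and "x \<in> carrier (singular_artin_monoid S m)"
  shows "artin_conj S m (\<alpha> \<otimes>\<^bsub>artin_group S m\<^esub> \<beta>) x = artin_conj S m \<alpha> (artin_conj S m \<beta> x)"
proof -
  interpret A: group "artin_group S m" by (rule artin_group_group)
  interpret SA: monoid "singular_artin_monoid S m" by (rule singular_artin_monoid_monoid)
  show ?thesis unfolding artin_conj_def
    using assms
    by (simp add: A.inv_mult_group artin_incl_mult artin_incl_closed SA.m_assoc)
qed

lemma artin_conj_mult:
  assumes "\<alpha> \<in> carrier (artin_group S m)"
    and "x \<in> carrier (singular_artin_monoid S m)" "y \<in> carrier (singular_artin_monoid S m)"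
  shows "artin_conj S m \<alpha> (x \<otimes>\<^bsub>singular_artin_monoid S m\<^esub> y)
    = artin_conj S m \<alpha> x \<otimes>\<^bsub>singular_artin_monoid S m\<^esub> artin_conj S m \<alpha> y"
proof -
  interpret A: group "artin_group S m" by (rule artin_group_group)
  interpret SA: monoid "singular_artin_monoid S m" by (rule singular_artin_monoid_monoid)
  let ?a = "artin_incl S m \<alpha>" and ?b = "artin_incl S m (inv\<^bsub>artin_group S m\<^esub> \<alpha>)"
  have c: "?a \<in> carrier (singular_artin_monoid S m)" "?b \<in> carrier (singular_artin_monoid S m)"
    using assms by (simp_all add: artin_incl_closed)
  have "?b \<otimes>\<^bsub>singular_artin_monoid S m\<^esub> ?a = \<one>\<^bsub>singular_artin_monoid S m\<^esub>"
    using assms by (simp add: artin_incl_one flip: artin_incl_mult)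
  then have "?b \<otimes>\<^bsub>singular_artin_monoid S m\<^esub> (?a \<otimes>\<^bsub>singular_artin_monoid S m\<^esub> z) = z"
    if "z \<in> carrier (singular_artin_monoid S m)" for z
    using that c by (simp flip: SA.m_assoc)
  then show ?thesis unfolding artin_conj_def using assms c by (simp add: SA.m_assoc)
qed

definition Upsilon_hat :: "'s set \<Rightarrow> ('s \<Rightarrow> 's \<Rightarrow> enat) \<Rightarrow> 's sing_letter list set set" where
  "Upsilon_hat S m =
    {artin_conj S m \<alpha> (sing_gen S m (Tau s)) | \<alpha> s. \<alpha> \<in> carrier (artin_group S m) \<and> s \<in> S}"

definition Omega_hat_edges :: "'s set \<Rightarrow> ('s \<Rightarrow> 's \<Rightarrow> enat) \<Rightarrow> 's sing_letter list set set set" where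
  "Omega_hat_edges S m =
    {{u, v} | u v. u \<in> Upsilon_hat S m \<and> v \<in> Upsilon_hat S m \<and> u \<noteq> v \<and>
       u \<otimes>\<^bsub>singular_artin_monoid S m\<^esub> v = v \<otimes>\<^bsub>singular_artin_monoid S m\<^esub> u}"

lemma Upsilon_hat_closed: "Upsilon_hat S m \<subseteq> carrier (singular_artin_monoid S m)"
proof -
  have "sing_gen S m (Tau s) \<in> carrier (singular_artin_monoid S m)" if "s \<in> S" for s
    unfolding sing_gen_def singular_artin_monoid_def
    using that by (intro presented_gen_closed) (auto simp: sing_letters_def)
  then show ?thesis unfolding Upsilon_hat_def by (auto intro!: artin_conj_closed)
qed

lemma artin_conj_Upsilon_hat:
  assumes "\<alpha> \<in> carrier (artin_group S m)" "u \<in> Upsilon_hat S m"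
  shows "artin_conj S m \<alpha> u \<in> Upsilon_hat S m"
proof -
  interpret A: group "artin_group S m" by (rule artin_group_group)
  obtain \<beta> s where b: "\<beta> \<in> carrier (artin_group S m)" "s \<in> S"
    "u = artin_conj S m \<beta> (sing_gen S m (Tau s))"
    using assms unfolding Upsilon_hat_def by auto
  have "sing_gen S m (Tau s) \<in> carrier (singular_artin_monoid S m)"
    unfolding sing_gen_def singular_artin_monoid_def
    using b by (intro presented_gen_closed) (auto simp: sing_letters_def)
  then have "artin_conj S m \<alpha> u
      = artin_conj S m (\<alpha> \<otimes>\<^bsub>artin_group S m\<^esub> \<beta>) (sing_gen S m (Tau s))"
    using artin_conj_comp assms b by metis
  then show ?thesis unfolding Upsilon_hat_def using assms b by auto
qed

lemma artin_conj_inj: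
  assumes "\<alpha> \<in> carrier (artin_group S m)"
  shows "inj_on (artin_conj S m \<alpha>) (carrier (singular_artin_monoid S m))"
proof -
  interpret A: group "artin_group S m" by (rule artin_group_group)
  show ?thesis
    by (rule inj_on_inverseI[where g = "artin_conj S m (inv\<^bsub>artin_group S m\<^esub> \<alpha>)"])
      (use assms in \<open>simp add: artin_conj_one flip: artin_conj_comp\<close>)
qed

lemma artin_conj_edge:
  assumes "\<alpha> \<in> carrier (artin_group S m)" "{u, v} \<in> Omega_hat_edges S m"
  shows "{artin_conj S m \<alpha> u, artin_conj S m \<alpha> v} \<in> Omega_hat_edges S m"
proof -
  have uv: "u \<in> Upsilon_hat S m" "v \<in> Upsilon_hat S m" "u \<noteq> v"
    "u \<otimes>\<^bsub>singular_artin_monoid S m\<^esub> v = v \<otimes>\<^bsub>singular_artin_monoid S m\<^esub> u"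
    using assms(2) unfolding Omega_hat_edges_def by (auto simp: doubleton_eq_iff)
  have c: "u \<in> carrier (singular_artin_monoid S m)" "v \<in> carrier (singular_artin_monoid S m)"
    using uv Upsilon_hat_closed by blast+
  have "artin_conj S m \<alpha> u \<noteq> artin_conj S m \<alpha> v"
    using inj_onD[OF artin_conj_inj[OF assms(1)]] c uv by blast
  moreover have "artin_conj S m \<alpha> u \<otimes>\<^bsub>singular_artin_monoid S m\<^esub> artin_conj S m \<alpha> v
      = artin_conj S m \<alpha> v \<otimes>\<^bsub>singular_artin_monoid S m\<^esub> artin_conj S m \<alpha> u"
    using artin_conj_mult[OF assms(1)] c uv by metis
  ultimately show ?thesis
    unfolding Omega_hat_edges_def using artin_conj_Upsilon_hat[OF assms(1)] uv by blast
qed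

definition Omega_hat_monoid ::
  "'s set \<Rightarrow> ('s \<Rightarrow> 's \<Rightarrow> enat) \<Rightarrow> 's sing_letter list set list set monoid" where
  "Omega_hat_monoid S m = graph_monoid (Upsilon_hat S m) (Omega_hat_edges S m)"

definition Omega_hat_gen ::
  "'s set \<Rightarrow> ('s \<Rightarrow> 's \<Rightarrow> enat) \<Rightarrow> 's sing_letter list set \<Rightarrow> 's sing_letter list set list set" where
  "Omega_hat_gen S m = graph_gen (Upsilon_hat S m) (Omega_hat_edges S m)"

definition conj_action ::
  "'s set \<Rightarrow> ('s \<Rightarrow> 's \<Rightarrow> enat) \<Rightarrow> 's signed list set
    \<Rightarrow> 's sing_letter list set list set \<Rightarrow> 's sing_letter list set list set" where
  "conj_action S m \<alpha> =
    presented_lift (Omega_hat_monoid S m) (\<lambda>u. Omega_hat_gen S m (artin_conj S m \<alpha> u))"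

text \<open>\<open>conj_action\<close> is an action of \<open>A\<close> by automorphisms, so that the semidirect product is defined.\<close>

lemma
  assumes "\<alpha> \<in> carrier (artin_group S m)"
  shows conj_action_class: "w \<in> lists (Upsilon_hat S m) \<Longrightarrow>
      conj_action S m \<alpha> (word_cong (Upsilon_hat S m) (graph_relations (Omega_hat_edges S m)) `` {w})
      = word_cong (Upsilon_hat S m) (graph_relations (Omega_hat_edges S m)) `` {map (artin_conj S m \<alpha>) w}"
    and conj_action_hom: "conj_action S m \<alpha> \<in> hom (Omega_hat_monoid S m) (Omega_hat_monoid S m)"
proof -
  let ?V = "Upsilon_hat S m" and ?R = "graph_relations (Omega_hat_edges S m)"
  let ?g = "artin_conj S m \<alpha>" and ?f = "\<lambda>u. Omega_hat_gen S m (artin_conj S m \<alpha> u)"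
  have M: "Omega_hat_monoid S m = presented_monoid ?V ?R"
    unfolding Omega_hat_monoid_def graph_monoid_def ..
  have g: "?g ` ?V \<subseteq> ?V" using artin_conj_Upsilon_hat[OF assms] by auto
  have f: "?f \<in> ?V \<rightarrow> carrier (presented_monoid ?V ?R)"
    using g unfolding Omega_hat_gen_def graph_gen_def by (auto intro: presented_gen_closed)
  have ev: "word_eval (presented_monoid ?V ?R) ?f w = word_cong ?V ?R `` {map ?g w}"
    if "w \<in> lists ?V" for w
    using word_eval_gens[OF that g] unfolding Omega_hat_gen_def graph_gen_def .
  have resp: "word_eval (presented_monoid ?V ?R) ?f u = word_eval (presented_monoid ?V ?R) ?f v"
    if "(u, v) \<in> ?R" "u \<in> lists ?V" "v \<in> lists ?V" for u v
  proof -
    have "(map ?g u, map ?g v) \<in> ?R"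
      using that(1) artin_conj_edge[OF assms] unfolding graph_relations_def by auto
    moreover have "map ?g u \<in> lists ?V" "map ?g v \<in> lists ?V"
      using that artin_conj_Upsilon_hat[OF assms] by auto
    ultimately have "(map ?g u, map ?g v) \<in> word_cong ?V ?R"
      using word_cong.rel[of "map ?g u" "map ?g v" ?R ?V "[]" "[]"] by simp
    from class_eqI[OF this] show ?thesis using ev[OF that(2)] ev[OF that(3)] by simp
  qed
  show "conj_action S m \<alpha> \<in> hom (Omega_hat_monoid S m) (Omega_hat_monoid S m)"
    unfolding conj_action_def M
    by (rule presented_lift_hom[OF presented_monoid_monoid f resp])
  show "conj_action S m \<alpha> (word_cong ?V ?R `` {w}) = word_cong ?V ?R `` {map ?g w}"
    if "w \<in> lists ?V"
    unfolding conj_action_def M ev[OF that, symmetric]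
    by (rule presented_lift_class[OF presented_monoid_monoid f resp that])
qed

lemma conj_action_one:
  assumes "x \<in> carrier (Omega_hat_monoid S m)"
  shows "conj_action S m \<one>\<^bsub>artin_group S m\<^esub> x = x"
proof -
  interpret A: group "artin_group S m" by (rule artin_group_group)
  obtain w where w: "w \<in> lists (Upsilon_hat S m)"
    "x = word_cong (Upsilon_hat S m) (graph_relations (Omega_hat_edges S m)) `` {w}"
    using assms unfolding Omega_hat_monoid_def graph_monoid_def presented_monoid_carrier by blast
  have "map (artin_conj S m \<one>\<^bsub>artin_group S m\<^esub>) w = w"
    using w(1) Upsilon_hat_closed by (intro map_idI artin_conj_one) auto
  then show ?thesis using w conj_action_class[OF A.one_closed w(1)] by simp
qed

lemma conj_action_comp:
  assumes "\<alpha> \<in> carrier (artin_group S m)" "\<beta> \<in> carrier (artin_group S m)"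
    and "x \<in> carrier (Omega_hat_monoid S m)"
  shows "conj_action S m (\<alpha> \<otimes>\<^bsub>artin_group S m\<^esub> \<beta>) x = conj_action S m \<alpha> (conj_action S m \<beta> x)"
proof -
  interpret A: group "artin_group S m" by (rule artin_group_group)
  obtain w where w: "w \<in> lists (Upsilon_hat S m)"
    "x = word_cong (Upsilon_hat S m) (graph_relations (Omega_hat_edges S m)) `` {w}"
    using assms unfolding Omega_hat_monoid_def graph_monoid_def presented_monoid_carrier by blast
  have w': "map (artin_conj S m \<beta>) w \<in> lists (Upsilon_hat S m)"
    using w(1) artin_conj_Upsilon_hat[OF assms(2)] by auto
  have "map (artin_conj S m (\<alpha> \<otimes>\<^bsub>artin_group S m\<^esub> \<beta>)) w
      = map (artin_conj S m \<alpha>) (map (artin_conj S m \<beta>) w)"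
    unfolding map_map comp_def
    by (intro map_cong[OF HOL.refl] artin_conj_comp[OF assms(1,2)] subsetD[OF Upsilon_hat_closed])
      (use w(1) in auto)
  then show ?thesis
    unfolding w(2) conj_action_class[OF A.m_closed[OF assms(1,2)] w(1)]
      conj_action_class[OF assms(2) w(1)] conj_action_class[OF assms(1) w'] by (rule arg_cong)
qed

lemma conj_action_iso:
  assumes "\<alpha> \<in> carrier (artin_group S m)"
  shows "conj_action S m \<alpha> \<in> iso (Omega_hat_monoid S m) (Omega_hat_monoid S m)"
proof -
  interpret A: group "artin_group S m" by (rule artin_group_group)
  let ?b = "inv\<^bsub>artin_group S m\<^esub> \<alpha>"
  have b: "?b \<in> carrier (artin_group S m)" using assms by simp
  have "conj_action S m ?b (conj_action S m \<alpha> x) = x"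
    "conj_action S m \<alpha> (conj_action S m ?b x) = x"
    if "x \<in> carrier (Omega_hat_monoid S m)" for x
    using conj_action_comp[OF b assms that] conj_action_comp[OF assms b that] conj_action_one[OF that]
      A.l_inv[OF assms] A.r_inv[OF assms] by simp_all
  then have "bij_betw (conj_action S m \<alpha>)
      (carrier (Omega_hat_monoid S m)) (carrier (Omega_hat_monoid S m))"
    using hom_in_carrier[OF conj_action_hom[OF assms]] hom_in_carrier[OF conj_action_hom[OF b]]
    by (intro bij_betw_byWitness[where f' = "conj_action S m ?b"]) blast+
  then show ?thesis using conj_action_hom[OF assms] unfolding iso_def by simp
qed

text \<open>The map \<open>(x, \<alpha>) \<mapsto> \<pi>(x) \<alpha>\<close>, where \<open>\<pi>\<close> is the homomorphism from the graph monoid to \<open>SA\<close>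
  fixing each vertex \<open>u\<close>: vertices are themselves elements of \<open>SA\<close>.\<close>

definition natural_hom ::
  "'s set \<Rightarrow> ('s \<Rightarrow> 's \<Rightarrow> enat) \<Rightarrow> 's sing_letter list set list set \<times> 's signed list set
    \<Rightarrow> 's sing_letter list set" where
  "natural_hom S m = (\<lambda>(x, \<alpha>). presented_lift (singular_artin_monoid S m) (\<lambda>u. u) x
    \<otimes>\<^bsub>singular_artin_monoid S m\<^esub> artin_incl S m \<alpha>)"

end

theory Submission
  imports Defs
begin

text \<open>The defining relations of \<open>SA\<close> hold in \<open>\<M>(\<Omega>) \<rtimes> A\<close> for the elements
  \<open>(1, \<sigma>\<^sub>s\<^sup>\<plusminus>\<^sup>1)\<close> and \<open>(\<tau>\<^sub>s, 1)\<close>: a relation \<open>w \<tau>\<^sub>s = \<tau>\<^sub>t w\<close> with \<open>w \<in> A\<close> says that conjugation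
  by \<open>w\<close> maps the vertex \<open>\<tau>\<^sub>s\<close> to the vertex \<open>\<tau>\<^sub>t\<close>, and two commuting \<open>\<tau>\<^sub>s\<close>, \<open>\<tau>\<^sub>t\<close> are equal or
  adjacent vertices. The resulting homomorphism from \<open>SA\<close> is inverse to the natural one,
  since both composites fix generators.\<close>

section \<open>Presented monoids and semidirect products\<close>

text \<open>Induction on a representing word, splitting off its first letter. Agreement at the unit
  is assumed separately because \<open>hom\<close> records multiplicativity only; it is the base
  case of the induction.\<close>

lemma presented_hom_eqI:
  assumes h: "h \<in> hom (presented_monoid X R) N" and k: "k \<in> hom (presented_monoid X R) N"
    and one: "h \<one>\<^bsub>presented_monoid X R\<^esub> = k \<one>\<^bsub>presented_monoid X R\<^esub>"
    and gen: "\<And>x. x \<in> X \<Longrightarrow> h (presented_gen X R x) = k (presented_gen X R x)"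
    and c: "c \<in> carrier (presented_monoid X R)"
  shows "h c = k c"
proof -
  have "h (word_cong X R `` {w}) = k (word_cong X R `` {w})" if "w \<in> lists X" for w
    using that
  proof induction
    case Nil
    show ?case using one by (simp add: presented_monoid_one)
  next
    case (Cons a l)
    have split: "word_cong X R `` {a # l}
        = presented_gen X R a \<otimes>\<^bsub>presented_monoid X R\<^esub> word_cong X R `` {l}"
      using presented_monoid_mult[of "[a]" X l R] Cons(1,2) unfolding presented_gen_def by simp
    have "word_cong X R `` {l} \<in> carrier (presented_monoid X R)"
      using Cons(2) presented_monoid_carrier by blast
    then show ?case
      unfolding split
      using hom_mult[OF h] hom_mult[OF k] presented_gen_closed[OF Cons(1)] gen[OF Cons(1)] Cons.IH
      by simp
  qed
  then show ?thesis using c unfolding presented_monoid_carrier by blast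
qed

lemma semidirect_product_simps [simp]:
  "carrier (semidirect_product M G \<phi>) = carrier M \<times> carrier G"
  "\<one>\<^bsub>semidirect_product M G \<phi>\<^esub> = (\<one>\<^bsub>M\<^esub>, \<one>\<^bsub>G\<^esub>)"
  "(x, g) \<otimes>\<^bsub>semidirect_product M G \<phi>\<^esub> (y, h) = (x \<otimes>\<^bsub>M\<^esub> \<phi> g y, g \<otimes>\<^bsub>G\<^esub> h)"
  unfolding semidirect_product_def by simp_all

text \<open>Associativity amounts to each \<open>\<phi> g\<close> being multiplicative together with
  \<open>act_mult\<close>; the unit laws amount to \<open>one\<close> and \<open>act_one\<close>. As
  \<open>hom\<close> says nothing about units, \<open>one\<close> is an assumption of its
  own.\<close>

lemma semidirect_product_monoid:
  assumes "monoid M" "monoid G"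
    and hom: "\<And>g. g \<in> carrier G \<Longrightarrow> \<phi> g \<in> hom M M"
    and one: "\<And>g. g \<in> carrier G \<Longrightarrow> \<phi> g \<one>\<^bsub>M\<^esub> = \<one>\<^bsub>M\<^esub>"
    and act_one: "\<And>x. x \<in> carrier M \<Longrightarrow> \<phi> \<one>\<^bsub>G\<^esub> x = x"
    and act_mult: "\<And>g h x. g \<in> carrier G \<Longrightarrow> h \<in> carrier G \<Longrightarrow> x \<in> carrier M
      \<Longrightarrow> \<phi> (g \<otimes>\<^bsub>G\<^esub> h) x = \<phi> g (\<phi> h x)"
  shows "monoid (semidirect_product M G \<phi>)"
proof -
  interpret M: monoid M by fact
  interpret G: monoid G by fact
  note closed = hom_in_carrier[OF hom]
  show ?thesis
    by (rule monoidI)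
      (auto simp: closed one act_one act_mult hom_mult[OF hom] M.m_assoc G.m_assoc)
qed

section \<open>The Artin group inside the singular Artin monoid\<close>

context
  fixes S :: "'s set" and m :: "'s \<Rightarrow> 's \<Rightarrow> enat"
begin

definition artin_letters :: "'s signed set" where
  "artin_letters = Pos ` S \<union> Neg ` S"

text \<open>The cancellation relations are included, so that the Artin group is literally a
  presented monoid and can be handled through words over \<open>artin_letters\<close>.\<close>

definition artin_relations :: "('s signed list \<times> 's signed list) set" where
  "artin_relations =
    {(alt_word k (Pos s) (Pos t), alt_word k (Pos t) (Pos s)) | s t k.
       s \<in> S \<and> t \<in> S \<and> s \<noteq> t \<and> m s t = enat k}
     \<union> {([Pos x, Neg x], []) | x. x \<in> S} \<union> {([Neg x, Pos x], []) | x. x \<in> S}"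

definition sing_of_signed :: "'s signed \<Rightarrow> 's sing_letter" where
  "sing_of_signed = case_signed Sig SigInv"

lemma sing_of_signed_simps [simp]:
  "sing_of_signed (Pos s) = Sig s" "sing_of_signed (Neg s) = SigInv s"
  unfolding sing_of_signed_def by simp_all

abbreviation (input) "A \<equiv> artin_group S m"
abbreviation (input) "SA \<equiv> singular_artin_monoid S m"
abbreviation (input) "M \<equiv> Omega_hat_monoid S m"
abbreviation (input) "P \<equiv> semidirect_product M A (conj_action S m)"
abbreviation (input) "tau s \<equiv> sing_gen S m (Tau s)"
abbreviation (input) "artin_cong \<equiv> word_cong artin_letters artin_relations"
abbreviation (input) "sing_cong \<equiv> word_cong (sing_letters S) (sing_relations S m)"

lemma artin_letters_iff [simp]: "Pos s \<in> artin_letters \<longleftrightarrow> s \<in> S" "Neg s \<in> artin_letters \<longleftrightarrow> s \<in> S"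
  unfolding artin_letters_def by auto

lemma artin_group_presented: "A = presented_monoid artin_letters artin_relations"
  unfolding artin_group_def presented_group_def artin_letters_def artin_relations_def ..

interpretation A: group A by (rule artin_group_group)
interpretation SA: monoid SA by (rule singular_artin_monoid_monoid)

lemma Omega_hat_presented:
  "M = presented_monoid (Upsilon_hat S m) (graph_relations (Omega_hat_edges S m))"
  unfolding Omega_hat_monoid_def graph_monoid_def ..

interpretation M: monoid M
  unfolding Omega_hat_presented by (rule presented_monoid_monoid)

lemma sing_of_signed_letters: "sing_of_signed ` artin_letters \<subseteq> sing_letters S"
  unfolding artin_letters_def sing_letters_def by auto

lemma map_sing_of_signed_lists:
  "w \<in> lists artin_letters \<Longrightarrow> map sing_of_signed w \<in> lists (sing_letters S)"
  using sing_of_signed_letters by fastforce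

lemma artin_class_closed: "w \<in> lists artin_letters \<Longrightarrow> artin_cong `` {w} \<in> carrier A"
  unfolding artin_group_presented presented_monoid_carrier by blast

lemma map_alt_word: "map f (alt_word k a b) = alt_word k (f a) (f b)"
  by (induction k arbitrary: a b) auto

lemma set_alt_word: "set (alt_word k a b) \<subseteq> {a, b}"
  by (induction k arbitrary: a b) auto

lemma alt_word_lists: "a \<in> X \<Longrightarrow> b \<in> X \<Longrightarrow> alt_word k a b \<in> lists X"
  using set_alt_word[of k a b] by auto

lemma artin_relation_cong:
  assumes "(u, v) \<in> artin_relations" shows "(u, v) \<in> artin_cong"
proof -
  have "u \<in> lists artin_letters" "v \<in> lists artin_letters"
    using assms unfolding artin_relations_def by (auto dest!: subsetD[OF set_alt_word])
  then show ?thesis using word_cong.rel[OF assms, of artin_letters "[]" "[]"] by simp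
qed

lemma sing_relation_cong:
  assumes "(u, v) \<in> sing_relations S m" "u \<in> lists (sing_letters S)" "v \<in> lists (sing_letters S)"
  shows "(u, v) \<in> sing_cong"
  using word_cong.rel[OF assms, of "[]" "[]"] by simp

lemma Tau_letter: "s \<in> S \<Longrightarrow> Tau s \<in> sing_letters S"
  unfolding sing_letters_def by auto

lemma tau_closed: "s \<in> S \<Longrightarrow> tau s \<in> carrier SA"
  unfolding sing_gen_def singular_artin_monoid_def by (intro presented_gen_closed Tau_letter)

lemma tau_Upsilon_hat: "s \<in> S \<Longrightarrow> tau s \<in> Upsilon_hat S m"
  unfolding Upsilon_hat_def using artin_conj_one[OF tau_closed] A.one_closed by force

text \<open>A \<open>presented_lift\<close> takes the expected value on a generator once the
  defining relations are respected. Here they are, since each relation of the Artin group is carried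
  letter by letter to a relation of \<open>SA\<close>.\<close>

lemma artin_incl_gen:
  assumes "a \<in> artin_letters"
  shows "artin_incl S m (presented_gen artin_letters artin_relations a)
    = sing_gen S m (sing_of_signed a)"
proof -
  let ?f = "\<lambda>x. sing_gen S m (sing_of_signed x)"
  \<comment> \<open>Pulling \<open>sing_gen\<close> out of the case distinction gives the shape that
    \<open>word_eval_gens\<close> expects: a map of letters followed by the generator map.\<close>
  have I: "artin_incl S m = presented_lift SA ?f"
    unfolding artin_incl_def sing_of_signed_def
    by (rule arg_cong[of _ _ "presented_lift _"]) (rule ext, simp split: signed.split)
  have f: "?f \<in> artin_letters \<rightarrow> carrier SA"
    using sing_of_signed_letters unfolding sing_gen_def singular_artin_monoid_def
    by (auto intro: presented_gen_closed)
  have "word_eval SA ?f u = word_eval SA ?f v"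
    if uv: "(u, v) \<in> artin_relations" "u \<in> lists artin_letters" "v \<in> lists artin_letters"
    for u v
  proof -
    have "(map sing_of_signed u, map sing_of_signed v) \<in> sing_relations S m"
    proof -
      consider (braid) s t k where "s \<in> S" "t \<in> S" "s \<noteq> t" "m s t = enat k"
          "u = alt_word k (Pos s) (Pos t)" "v = alt_word k (Pos t) (Pos s)"
        | (inv) s where "s \<in> S" "v = []" "u = [Pos s, Neg s] \<or> u = [Neg s, Pos s]"
        using uv(1) unfolding artin_relations_def by blast
      then show ?thesis
      proof cases
        case braid
        then show ?thesis unfolding sing_relations_def by (simp add: map_alt_word) blast
      next
        case inv
        then show ?thesis unfolding sing_relations_def by auto
      qed
    qed
    from class_eqI[OF sing_relation_cong[OF this
        map_sing_of_signed_lists[OF uv(2)] map_sing_of_signed_lists[OF uv(3)]]]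
    show ?thesis
      using word_eval_gens[OF uv(2) sing_of_signed_letters]
        word_eval_gens[OF uv(3) sing_of_signed_letters]
      unfolding singular_artin_monoid_def sing_gen_def by simp
  qed
  then show ?thesis unfolding I by (rule presented_lift_gen[OF SA.monoid_axioms f _ assms])
qed

text \<open>Multiplicativity extends the values on letters to words. The explicit representative
  lets relations between words of \<open>SA\<close> be read as equations about images of elements of
  \<open>A\<close>.\<close>

lemma artin_incl_class:
  assumes "w \<in> lists artin_letters"
  shows "artin_incl S m (artin_cong `` {w}) = sing_cong `` {map sing_of_signed w}"
  using assms
proof induction
  case Nil
  show ?case using artin_incl_one[of S m]
    unfolding artin_group_presented singular_artin_monoid_def by (simp add: presented_monoid_one)
next
  case (Cons a l)
  have l: "[sing_of_signed a] \<in> lists (sing_letters S)" "map sing_of_signed l \<in> lists (sing_letters S)"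
    using Cons map_sing_of_signed_lists[of "[a]"] map_sing_of_signed_lists[of l] by auto
  have a: "[a] \<in> lists artin_letters" using Cons by simp
  have "artin_cong `` {a # l} = artin_cong `` {[a]} \<otimes>\<^bsub>A\<^esub> artin_cong `` {l}"
    using presented_monoid_mult[OF a Cons(2)] unfolding artin_group_presented by simp
  then show ?case
    using artin_incl_gen[OF Cons(1)] Cons.IH presented_monoid_mult[OF l]
    by (simp add: artin_incl_mult artin_class_closed[OF a] artin_class_closed[OF Cons(2)]
        sing_gen_def presented_gen_def singular_artin_monoid_def)
qed

section \<open>Conjugation by the Artin group in the singular Artin monoid\<close>

lemma artin_incl_inv:
  assumes "\<alpha> \<in> carrier A"
  shows "artin_incl S m \<alpha> \<otimes>\<^bsub>SA\<^esub> artin_incl S m (inv\<^bsub>A\<^esub> \<alpha>) = \<one>\<^bsub>SA\<^esub>"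
    and "artin_incl S m (inv\<^bsub>A\<^esub> \<alpha>) \<otimes>\<^bsub>SA\<^esub> artin_incl S m \<alpha> = \<one>\<^bsub>SA\<^esub>"
  using assms by (simp_all add: artin_incl_one flip: artin_incl_mult)

text \<open>Multiply the equation on the right by the image of the inverse of
  \<open>\<alpha>\<close>. In this way a sliding relation of \<open>SA\<close> becomes an identity
  between vertices.\<close>

lemma artin_conj_eqI:
  assumes "\<alpha> \<in> carrier A" "x \<in> carrier SA" "y \<in> carrier SA"
    and "artin_incl S m \<alpha> \<otimes>\<^bsub>SA\<^esub> x = y \<otimes>\<^bsub>SA\<^esub> artin_incl S m \<alpha>"
  shows "artin_conj S m \<alpha> x = y"
  unfolding artin_conj_def using assms
  by (simp add: SA.m_assoc artin_incl_closed artin_incl_inv)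

text \<open>The inverse inside the conjugate cancels against \<open>\<alpha>\<close>. This is the
  exchange rule that moves \<open>\<alpha>\<close> past an element of \<open>SA\<close>.\<close>

lemma artin_conj_incl:
  assumes "\<alpha> \<in> carrier A" "x \<in> carrier SA"
  shows "artin_conj S m \<alpha> x \<otimes>\<^bsub>SA\<^esub> artin_incl S m \<alpha> = artin_incl S m \<alpha> \<otimes>\<^bsub>SA\<^esub> x"
  unfolding artin_conj_def using assms
  by (simp add: SA.m_assoc artin_incl_closed artin_incl_inv)

section \<open>The natural homomorphism\<close>

lemma Omega_hat_gen_closed: "u \<in> Upsilon_hat S m \<Longrightarrow> Omega_hat_gen S m u \<in> carrier M"
  unfolding Omega_hat_gen_def graph_gen_def Omega_hat_presented by (rule presented_gen_closed)

lemma conj_action_unit: "\<alpha> \<in> carrier A \<Longrightarrow> conj_action S m \<alpha> \<one>\<^bsub>M\<^esub> = \<one>\<^bsub>M\<^esub>"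
  using conj_action_class[of \<alpha> S m "[]"] unfolding Omega_hat_presented presented_monoid_one by simp

lemma conj_action_gen:
  "\<alpha> \<in> carrier A \<Longrightarrow> u \<in> Upsilon_hat S m
    \<Longrightarrow> conj_action S m \<alpha> (Omega_hat_gen S m u) = Omega_hat_gen S m (artin_conj S m \<alpha> u)"
  using conj_action_class[of \<alpha> S m "[u]"]
  unfolding Omega_hat_gen_def graph_gen_def presented_gen_def by simp

interpretation P: monoid P
  by (rule semidirect_product_monoid)
    (auto simp: M.monoid_axioms A.monoid_axioms conj_action_hom conj_action_unit
      conj_action_one conj_action_comp)

abbreviation (input) "vertex_lift \<equiv> presented_lift SA (\<lambda>u. u)"

text \<open>The endpoints of an edge commute in \<open>SA\<close> by the definition of the edges, so
  the identity on vertices respects the relations of the graph monoid.\<close>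

lemma vertex_lift_hom: "vertex_lift \<in> hom M SA"
  and vertex_lift_one: "vertex_lift \<one>\<^bsub>M\<^esub> = \<one>\<^bsub>SA\<^esub>"
  and vertex_lift_gen: "u \<in> Upsilon_hat S m \<Longrightarrow> vertex_lift (Omega_hat_gen S m u) = u"
proof -
  have f: "(\<lambda>u. u) \<in> Upsilon_hat S m \<rightarrow> carrier SA" using Upsilon_hat_closed by auto
  have resp: "word_eval SA (\<lambda>u. u) u = word_eval SA (\<lambda>u. u) v"
    if uv: "(u, v) \<in> graph_relations (Omega_hat_edges S m)" for u v
  proof -
    obtain a b where ab: "u = [a, b]" "v = [b, a]" "{a, b} \<in> Omega_hat_edges S m"
      using uv unfolding graph_relations_def by blast
    then have "a \<in> Upsilon_hat S m" "b \<in> Upsilon_hat S m" "a \<otimes>\<^bsub>SA\<^esub> b = b \<otimes>\<^bsub>SA\<^esub> a"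
      unfolding Omega_hat_edges_def by (auto simp: doubleton_eq_iff)
    then show ?thesis using subsetD[OF Upsilon_hat_closed[of S m]] ab by simp
  qed
  note lift = SA.monoid_axioms f resp
  show "vertex_lift \<in> hom M SA"
    unfolding Omega_hat_presented by (rule presented_lift_hom[OF lift])
  show "vertex_lift \<one>\<^bsub>M\<^esub> = \<one>\<^bsub>SA\<^esub>"
    unfolding Omega_hat_presented by (rule presented_lift_one[OF lift])
  show "vertex_lift (Omega_hat_gen S m u) = u" if "u \<in> Upsilon_hat S m"
    unfolding Omega_hat_gen_def graph_gen_def by (rule presented_lift_gen[OF lift that])
qed

lemma vertex_lift_closed: "x \<in> carrier M \<Longrightarrow> vertex_lift x \<in> carrier SA"
  by (rule hom_in_carrier[OF vertex_lift_hom])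

text \<open>Equivariance of \<open>vertex_lift\<close>: both sides are homomorphisms in
  \<open>x\<close>, and on a vertex \<open>u\<close> both give the conjugate of
  \<open>u\<close>.\<close>

lemma vertex_lift_conj_action:
  assumes "\<alpha> \<in> carrier A" "x \<in> carrier M"
  shows "vertex_lift (conj_action S m \<alpha> x) = artin_conj S m \<alpha> (vertex_lift x)"
proof -
  have "(\<lambda>x. vertex_lift (conj_action S m \<alpha> x)) \<in> hom M SA"
    using hom_compose[OF conj_action_hom[OF assms(1)] vertex_lift_hom] by (simp add: comp_def)
  moreover have "artin_conj S m \<alpha> \<in> hom SA SA"
    using assms(1) by (intro homI artin_conj_closed artin_conj_mult)
  then have "(\<lambda>x. artin_conj S m \<alpha> (vertex_lift x)) \<in> hom M SA"
    using hom_compose[OF vertex_lift_hom] by (fastforce simp: comp_def)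
  \<comment> \<open>Conjugation fixes the unit: this is \<open>artin_conj_eqI\<close> with both
    elements equal to 1.\<close>
  moreover have "vertex_lift (conj_action S m \<alpha> \<one>\<^bsub>M\<^esub>) = artin_conj S m \<alpha> (vertex_lift \<one>\<^bsub>M\<^esub>)"
    using assms(1)
    using artin_conj_eqI[of \<alpha> "\<one>\<^bsub>SA\<^esub>" "\<one>\<^bsub>SA\<^esub>"]
    by (simp add: conj_action_unit vertex_lift_one artin_incl_closed)
  moreover have "vertex_lift (conj_action S m \<alpha> (Omega_hat_gen S m u))
      = artin_conj S m \<alpha> (vertex_lift (Omega_hat_gen S m u))" if "u \<in> Upsilon_hat S m" for u
    using assms(1) that by (simp add: conj_action_gen vertex_lift_gen artin_conj_Upsilon_hat)
  ultimately show ?thesis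
    using assms(2) unfolding Omega_hat_gen_def graph_gen_def Omega_hat_presented
    by (rule presented_hom_eqI)
qed

lemma natural_hom_pair: "natural_hom S m (x, \<alpha>) = vertex_lift x \<otimes>\<^bsub>SA\<^esub> artin_incl S m \<alpha>"
  unfolding natural_hom_def by simp

text \<open>By equivariance the twisted product in the first factor becomes a conjugate in
  \<open>SA\<close>, and the exchange rule undoes the conjugation.\<close>

lemma natural_hom_hom: "natural_hom S m \<in> hom P SA"
proof (rule homI)
  fix p q assume "p \<in> carrier P" "q \<in> carrier P"
  then obtain x \<alpha> y \<beta> where p: "p = (x, \<alpha>)" "x \<in> carrier M" "\<alpha> \<in> carrier A"
    and q: "q = (y, \<beta>)" "y \<in> carrier M" "\<beta> \<in> carrier A" by auto
  let ?a = "artin_incl S m \<alpha>" and ?b = "artin_incl S m \<beta>"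
  let ?x = "vertex_lift x" and ?y = "vertex_lift y"
  have closed: "?a \<in> carrier SA" "?b \<in> carrier SA" "?x \<in> carrier SA" "?y \<in> carrier SA"
    "artin_conj S m \<alpha> ?y \<in> carrier SA"
    using p q by (simp_all add: artin_incl_closed vertex_lift_closed artin_conj_closed)
  have "natural_hom S m (p \<otimes>\<^bsub>P\<^esub> q) = (?x \<otimes>\<^bsub>SA\<^esub> artin_conj S m \<alpha> ?y) \<otimes>\<^bsub>SA\<^esub> (?a \<otimes>\<^bsub>SA\<^esub> ?b)"
    using p q hom_in_carrier[OF conj_action_hom[OF p(3)] q(2)]
    by (simp add: natural_hom_pair hom_mult[OF vertex_lift_hom] vertex_lift_conj_action
        artin_incl_mult)
  \<comment> \<open>Rebracketing puts the conjugate of \<open>?y\<close> next to \<open>?a\<close>;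
    \<open>artin_conj_incl\<close> then replaces this product by \<open>?a\<close> times
    \<open>?y\<close>.\<close>
  also have "\<dots> = ?x \<otimes>\<^bsub>SA\<^esub> (artin_conj S m \<alpha> ?y \<otimes>\<^bsub>SA\<^esub> ?a) \<otimes>\<^bsub>SA\<^esub> ?b"
    using closed by (simp add: SA.m_assoc)
  also have "\<dots> = natural_hom S m p \<otimes>\<^bsub>SA\<^esub> natural_hom S m q"
    using closed p q by (simp add: artin_conj_incl natural_hom_pair SA.m_assoc)
  finally show "natural_hom S m (p \<otimes>\<^bsub>P\<^esub> q) = natural_hom S m p \<otimes>\<^bsub>SA\<^esub> natural_hom S m q" .
qed (auto simp: natural_hom_pair artin_incl_closed vertex_lift_closed)

lemma natural_hom_unit: "\<alpha> \<in> carrier A \<Longrightarrow> natural_hom S m (\<one>\<^bsub>M\<^esub>, \<alpha>) = artin_incl S m \<alpha>"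
  by (simp add: natural_hom_pair vertex_lift_one artin_incl_closed)

lemma natural_hom_graph: "x \<in> carrier M \<Longrightarrow> natural_hom S m (x, \<one>\<^bsub>A\<^esub>) = vertex_lift x"
  by (simp add: natural_hom_pair artin_incl_one vertex_lift_closed)

section \<open>The inverse homomorphism\<close>

abbreviation (input) "artin_gen \<equiv> presented_gen artin_letters artin_relations"

fun split_gen :: "'s sing_letter \<Rightarrow> 's sing_letter list set list set \<times> 's signed list set" where
  "split_gen (Sig s) = (\<one>\<^bsub>M\<^esub>, artin_gen (Pos s))"
| "split_gen (SigInv s) = (\<one>\<^bsub>M\<^esub>, artin_gen (Neg s))"
| "split_gen (Tau s) = (Omega_hat_gen S m (tau s), \<one>\<^bsub>A\<^esub>)"

abbreviation (input) "split_hom \<equiv> presented_lift P split_gen"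

section \<open>Defining relations of the singular Artin monoid in the semidirect product\<close>

lemma split_gen_sing_of_signed: "split_gen (sing_of_signed a) = (\<one>\<^bsub>M\<^esub>, artin_gen a)"
  by (cases a) simp_all

lemma artin_gen_closed: "a \<in> artin_letters \<Longrightarrow> artin_gen a \<in> carrier A"
  unfolding artin_group_presented by (rule presented_gen_closed)

lemma split_gen_closed: "split_gen \<in> sing_letters S \<rightarrow> carrier P"
  unfolding sing_letters_def
  by (auto intro!: artin_gen_closed Omega_hat_gen_closed tau_Upsilon_hat)

text \<open>The action fixes the unit of \<open>M\<close>, so elements with trivial first component
  multiply as in \<open>A\<close>.\<close>

lemma word_eval_split_artin:
  assumes "w \<in> lists artin_letters"
  shows "word_eval P split_gen (map sing_of_signed w) = (\<one>\<^bsub>M\<^esub>, artin_cong `` {w})"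
  using assms
proof induction
  case Nil
  show ?case unfolding artin_group_presented by (simp add: presented_monoid_one)
next
  case (Cons a l)
  have "artin_cong `` {a # l} = artin_gen a \<otimes>\<^bsub>A\<^esub> artin_cong `` {l}"
    using presented_monoid_mult[of "[a]" artin_letters l artin_relations] Cons(1,2)
    unfolding artin_group_presented presented_gen_def by simp
  then show ?case
    using Cons by (simp add: split_gen_sing_of_signed conj_action_unit artin_gen_closed)
qed

lemma word_eval_split_artin_relation:
  assumes "(u, v) \<in> artin_relations"
  shows "word_eval P split_gen (map sing_of_signed u) = word_eval P split_gen (map sing_of_signed v)"
proof -
  note cong = artin_relation_cong[OF assms]
  show ?thesis
    using word_cong_lists[OF cong] class_eqI[OF cong] by (simp add: word_eval_split_artin)
qed

text \<open>Treats both kinds of relation that move a \<open>Tau\<close> past a word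
  \<open>w\<close> in the invertible letters. In \<open>SA\<close> such a relation says that
  conjugation by the class of \<open>w\<close> takes \<open>tau s\<close> to \<open>tau t\<close>;
  in \<open>P\<close>, moving that class past a vertex applies the same conjugation.\<close>

lemma word_eval_split_slide:
  assumes w: "w \<in> lists artin_letters" and st: "s \<in> S" "t \<in> S"
    and rel: "(map sing_of_signed w @ [Tau s], [Tau t] @ map sing_of_signed w) \<in> sing_relations S m"
  shows "word_eval P split_gen (map sing_of_signed w @ [Tau s])
    = word_eval P split_gen ([Tau t] @ map sing_of_signed w)"
proof -
  let ?a = "artin_cong `` {w}" and ?w = "map sing_of_signed w"
  have l: "?w \<in> lists (sing_letters S)" "[Tau s] \<in> lists (sing_letters S)"
    "[Tau t] \<in> lists (sing_letters S)"
    using map_sing_of_signed_lists[OF w] Tau_letter st by auto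
  have a: "?a \<in> carrier A" using artin_class_closed[OF w] .
  \<comment> \<open>The relation is first used in \<open>SA\<close> itself: vertices are elements of
    \<open>SA\<close>, so this is where their equality is decided.\<close>
  have "sing_cong `` {?w @ [Tau s]} = sing_cong `` {[Tau t] @ ?w}"
    using l by (intro class_eqI sing_relation_cong[OF rel]) auto
  then have "artin_incl S m ?a \<otimes>\<^bsub>SA\<^esub> tau s = tau t \<otimes>\<^bsub>SA\<^esub> artin_incl S m ?a"
    unfolding artin_incl_class[OF w] sing_gen_def presented_gen_def singular_artin_monoid_def
    using presented_monoid_mult[OF l(1,2)] presented_monoid_mult[OF l(3,1)] by simp
  then have conj: "artin_conj S m ?a (tau s) = tau t"
    using a st by (intro artin_conj_eqI tau_closed)
  \<comment> \<open>Evaluating a one-letter word leaves a trailing unit, which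
    \<open>P.r_one\<close> removes.\<close>
  have "word_eval P split_gen (?w @ [Tau s]) = (\<one>\<^bsub>M\<^esub>, ?a) \<otimes>\<^bsub>P\<^esub> split_gen (Tau s)"
    using word_eval_append[OF P.monoid_axioms split_gen_closed l(1,2)] P.r_one[of "split_gen (Tau s)"]
      funcset_mem[OF split_gen_closed Tau_letter[OF st(1)]] word_eval_split_artin[OF w] by simp
  \<comment> \<open>Both products are the vertex \<open>tau t\<close> paired with \<open>?a\<close>:
    on the left through the action of \<open>?a\<close> on \<open>tau s\<close>, on the right
    because the action fixes the unit.\<close>
  also have "\<dots> = split_gen (Tau t) \<otimes>\<^bsub>P\<^esub> (\<one>\<^bsub>M\<^esub>, ?a)"
    using a st conj
    by (simp add: conj_action_gen tau_Upsilon_hat Omega_hat_gen_closed conj_action_unit)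
  finally show ?thesis using word_eval_split_artin[OF w] by simp
qed

text \<open>Distinct commuting vertices are adjacent, which gives a defining relation of the graph
  monoid. Edges join distinct vertices only, hence the separate case \<open>u = v\<close>.\<close>

lemma Omega_hat_gen_commute:
  assumes "u \<in> Upsilon_hat S m" "v \<in> Upsilon_hat S m" "u \<otimes>\<^bsub>SA\<^esub> v = v \<otimes>\<^bsub>SA\<^esub> u"
  shows "Omega_hat_gen S m u \<otimes>\<^bsub>M\<^esub> Omega_hat_gen S m v
    = Omega_hat_gen S m v \<otimes>\<^bsub>M\<^esub> Omega_hat_gen S m u"
proof (cases "u = v")
  case False
  let ?R = "graph_relations (Omega_hat_edges S m)"
  have l: "[u] \<in> lists (Upsilon_hat S m)" "[v] \<in> lists (Upsilon_hat S m)" using assms by auto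
  have "([u, v], [v, u]) \<in> ?R"
    using assms False unfolding graph_relations_def Omega_hat_edges_def by blast
  then have "([u, v], [v, u]) \<in> word_cong (Upsilon_hat S m) ?R"
    using word_cong.rel[of "[u, v]" "[v, u]" ?R "Upsilon_hat S m" "[]" "[]"] assms by simp
  from class_eqI[OF this] show ?thesis
    unfolding Omega_hat_gen_def graph_gen_def presented_gen_def Omega_hat_presented
    using presented_monoid_mult[OF l] presented_monoid_mult[OF l(2,1)] by simp
qed simp

lemma word_eval_split_respects:
  assumes "(u, v) \<in> sing_relations S m" "u \<in> lists (sing_letters S)" "v \<in> lists (sing_letters S)"
  shows "word_eval P split_gen u = word_eval P split_gen v"
proof -
  \<comment> \<open>The six families of relations fall into three types: cancellation and braid
    relations come from \<open>A\<close>, relations with a single \<open>Tau\<close> on each side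
    are slides, and the rest commute two \<open>Tau\<close> letters.\<close>
  consider (artin) u' v' where "(u', v') \<in> artin_relations"
      "u = map sing_of_signed u'" "v = map sing_of_signed v'"
    | (slide) w s t where "w \<in> lists artin_letters" "s \<in> S" "t \<in> S"
      "u = map sing_of_signed w @ [Tau s]" "v = [Tau t] @ map sing_of_signed w"
    | (commute) s t where "s \<in> S" "t \<in> S" "u = [Tau s, Tau t]" "v = [Tau t, Tau s]"
  proof -
    consider (1) s where "s \<in> S" "u = [Sig s, SigInv s]" "v = []"
      | (2) s where "s \<in> S" "u = [SigInv s, Sig s]" "v = []"
      | (3) s where "s \<in> S" "u = [Sig s, Tau s]" "v = [Tau s, Sig s]"
      | (4) s t k where "s \<in> S" "t \<in> S" "s \<noteq> t" "m s t = enat k"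
        "u = alt_word k (Sig s) (Sig t)" "v = alt_word k (Sig t) (Sig s)"
      | (5) s t k where "s \<in> S" "t \<in> S"
        "u = alt_word (k - 1) (Sig s) (Sig t) @ [Tau s]"
        "v = [Tau (if even k then s else t)] @ alt_word (k - 1) (Sig s) (Sig t)"
      | (6) s t where "s \<in> S" "t \<in> S" "u = [Tau s, Tau t]" "v = [Tau t, Tau s]"
      using assms(1) unfolding sing_relations_def by blast
    then show thesis
    proof cases
      case 1
      then show thesis by (intro artin[of "[Pos s, Neg s]" "[]"]) (auto simp: artin_relations_def)
    next
      case 2
      then show thesis by (intro artin[of "[Neg s, Pos s]" "[]"]) (auto simp: artin_relations_def)
    next
      \<comment> \<open>A slide along the one-letter word \<open>[Pos s]\<close> that returns to the
        same index.\<close>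
      case 3
      then show thesis by (intro slide[of "[Pos s]" s s]) simp_all
    next
      case 4
      then show thesis
        by (intro artin[of "alt_word k (Pos s) (Pos t)" "alt_word k (Pos t) (Pos s)"])
          (auto simp: artin_relations_def map_alt_word)
    next
      \<comment> \<open>The slide word has length \<open>k - 1\<close>, and the target index is the
        one that the parity of \<open>k\<close> selects.\<close>
      case 5
      then show thesis
        by (intro slide[of "alt_word (k - 1) (Pos s) (Pos t)" s "if even k then s else t"]
            alt_word_lists) (simp_all add: map_alt_word)
    next
      case 6
      then show thesis by (rule commute)
    qed
  qed
  then show ?thesis
  proof cases
    case artin
    then show ?thesis using word_eval_split_artin_relation by blast
  next
    case slide
    then show ?thesis using word_eval_split_slide assms(1) by blast
  next
    case commute
    have l: "[Tau s] \<in> lists (sing_letters S)" "[Tau t] \<in> lists (sing_letters S)"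
      using commute Tau_letter by auto
    have "tau s \<otimes>\<^bsub>SA\<^esub> tau t = tau t \<otimes>\<^bsub>SA\<^esub> tau s"
      using class_eqI[OF sing_relation_cong[OF assms]] commute
        presented_monoid_mult[OF l] presented_monoid_mult[OF l(2,1)]
      unfolding sing_gen_def presented_gen_def singular_artin_monoid_def by simp
    then show ?thesis
      using commute Omega_hat_gen_commute tau_Upsilon_hat
      by (simp add: conj_action_one Omega_hat_gen_closed)
  qed
qed

section \<open>The two composites\<close>

lemmas split_lift = P.monoid_axioms split_gen_closed word_eval_split_respects

lemma split_hom_hom: "split_hom \<in> hom SA P"
  unfolding singular_artin_monoid_def[of S m]
  by (rule presented_lift_hom[OF split_lift, unfolded singular_artin_monoid_def])

lemma split_hom_one: "split_hom \<one>\<^bsub>SA\<^esub> = \<one>\<^bsub>P\<^esub>"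
  using presented_lift_one[OF split_lift] unfolding singular_artin_monoid_def by blast

lemma split_hom_gen: "x \<in> sing_letters S \<Longrightarrow> split_hom (sing_gen S m x) = split_gen x"
  unfolding sing_gen_def by (rule presented_lift_gen[OF split_lift])

text \<open>Evaluate on a word representing \<open>\<alpha>\<close>. In particular
  \<open>artin_incl\<close> is injective on \<open>A\<close>.\<close>

lemma split_hom_artin_incl:
  assumes "\<alpha> \<in> carrier A" shows "split_hom (artin_incl S m \<alpha>) = (\<one>\<^bsub>M\<^esub>, \<alpha>)"
proof -
  obtain w where w: "w \<in> lists artin_letters" "\<alpha> = artin_cong `` {w}"
    using assms unfolding artin_group_presented presented_monoid_carrier by blast
  show ?thesis
    unfolding w(2) artin_incl_class[OF w(1)] word_eval_split_artin[OF w(1), symmetric]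
    by (rule presented_lift_class[OF split_lift map_sing_of_signed_lists[OF w(1)]])
qed

text \<open>A vertex is a conjugate of some \<open>tau s\<close>, and in a semidirect product
  conjugating an element of the first factor by an element of the second is the action.\<close>

lemma split_hom_vertex:
  assumes "u \<in> Upsilon_hat S m" shows "split_hom u = (Omega_hat_gen S m u, \<one>\<^bsub>A\<^esub>)"
proof -
  obtain \<alpha> s where u: "\<alpha> \<in> carrier A" "s \<in> S" "u = artin_conj S m \<alpha> (tau s)"
    using assms unfolding Upsilon_hat_def by blast
  have "split_hom u = (\<one>\<^bsub>M\<^esub>, \<alpha>) \<otimes>\<^bsub>P\<^esub> split_gen (Tau s) \<otimes>\<^bsub>P\<^esub> (\<one>\<^bsub>M\<^esub>, inv\<^bsub>A\<^esub> \<alpha>)"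
    unfolding u(3) artin_conj_def using u(1,2)
    by (simp add: hom_mult[OF split_hom_hom] artin_incl_closed tau_closed split_hom_artin_incl
        split_hom_gen Tau_letter del: split_gen.simps)
  also have "\<dots> = (Omega_hat_gen S m u, \<one>\<^bsub>A\<^esub>)"
    using u assms by (simp add: conj_action_gen tau_Upsilon_hat Omega_hat_gen_closed conj_action_unit)
  finally show ?thesis .
qed

text \<open>Both sides are homomorphisms from \<open>M\<close> to \<open>P\<close> that agree on
  vertices; the right one is multiplicative since the unit of \<open>A\<close> acts
  trivially.\<close>

lemma split_hom_vertex_lift:
  assumes "x \<in> carrier M" shows "split_hom (vertex_lift x) = (x, \<one>\<^bsub>A\<^esub>)"
proof -
  have "(\<lambda>x. split_hom (vertex_lift x)) \<in> hom M P"
    using hom_compose[OF vertex_lift_hom split_hom_hom] by (simp add: comp_def)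
  moreover have "(\<lambda>x. (x, \<one>\<^bsub>A\<^esub>)) \<in> hom M P"
    by (rule homI) (simp_all add: conj_action_one)
  moreover have "split_hom (vertex_lift \<one>\<^bsub>M\<^esub>) = (\<one>\<^bsub>M\<^esub>, \<one>\<^bsub>A\<^esub>)"
    by (simp add: vertex_lift_one split_hom_one)
  moreover have "split_hom (vertex_lift (Omega_hat_gen S m u)) = (Omega_hat_gen S m u, \<one>\<^bsub>A\<^esub>)"
    if "u \<in> Upsilon_hat S m" for u
    using that by (simp add: vertex_lift_gen split_hom_vertex)
  ultimately show ?thesis
    using assms unfolding Omega_hat_gen_def graph_gen_def Omega_hat_presented
    by (rule presented_hom_eqI)
qed

lemma split_hom_natural_hom:
  assumes "p \<in> carrier P" shows "split_hom (natural_hom S m p) = p"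
proof -
  obtain x \<alpha> where p: "p = (x, \<alpha>)" "x \<in> carrier M" "\<alpha> \<in> carrier A" using assms by auto
  then show ?thesis
    by (simp add: natural_hom_pair hom_mult[OF split_hom_hom] vertex_lift_closed artin_incl_closed
        split_hom_vertex_lift split_hom_artin_incl conj_action_one)
qed

text \<open>It suffices to compare on generators of \<open>SA\<close>: the \<open>Tau\<close>
  letters go through the vertices, all others through \<open>A\<close>.\<close>

lemma natural_hom_split_hom:
  assumes "y \<in> carrier SA" shows "natural_hom S m (split_hom y) = y"
proof -
  have "(\<lambda>y. natural_hom S m (split_hom y)) \<in> hom SA SA"
    using hom_compose[OF split_hom_hom natural_hom_hom] by (simp add: comp_def)
  moreover have "(\<lambda>y. y) \<in> hom SA SA" by (simp add: hom_def)
  moreover have "natural_hom S m (split_hom \<one>\<^bsub>SA\<^esub>) = \<one>\<^bsub>SA\<^esub>"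
    by (simp add: split_hom_one natural_hom_unit artin_incl_one)
  moreover have "natural_hom S m (split_hom (sing_gen S m x)) = sing_gen S m x"
    if x: "x \<in> sing_letters S" for x
  proof (cases "x \<in> Tau ` S")
    case True
    then show ?thesis
      using x by (auto simp: split_hom_gen natural_hom_graph Omega_hat_gen_closed tau_Upsilon_hat
          vertex_lift_gen)
  next
    case False
    then obtain a where "a \<in> artin_letters" "x = sing_of_signed a"
      using x unfolding sing_letters_def artin_letters_def
      by (metis Un_iff imageE image_eqI sing_of_signed_simps)
    then show ?thesis
      using x by (simp add: split_hom_gen split_gen_sing_of_signed natural_hom_unit
          artin_gen_closed artin_incl_gen)
  qed
  ultimately show ?thesis
    using assms unfolding sing_gen_def singular_artin_monoid_def by (rule presented_hom_eqI)
qed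

lemma natural_hom_iso: "natural_hom S m \<in> iso P SA"
proof -
  have "bij_betw (natural_hom S m) (carrier P) (carrier SA)"
    by (rule bij_betw_byWitness[where f' = split_hom])
      (use split_hom_natural_hom natural_hom_split_hom hom_in_carrier[OF natural_hom_hom]
        hom_in_carrier[OF split_hom_hom] in blast)+
  then show ?thesis using natural_hom_hom unfolding iso_def by blast
qed

end

text \<open>Membership in \<open>iso\<close> records multiplicativity and bijectivity, so the unit
  gets its own conjunct. The last two conjuncts identify the isomorphism as the natural map.\<close>

theorem proposition2p1:
  fixes S :: "'s set" and m :: "'s \<Rightarrow> 's \<Rightarrow> enat"
  assumes "finite S"
    and "coxeter_matrix S m"
  shows "natural_hom S m \<in> iso
           (semidirect_product (Omega_hat_monoid S m) (artin_group S m) (conj_action S m))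
           (singular_artin_monoid S m)
    \<and> natural_hom S m (\<one>\<^bsub>Omega_hat_monoid S m\<^esub>, \<one>\<^bsub>artin_group S m\<^esub>)
         = \<one>\<^bsub>singular_artin_monoid S m\<^esub>
    \<and> (\<forall>\<alpha>\<in>carrier (artin_group S m).
         natural_hom S m (\<one>\<^bsub>Omega_hat_monoid S m\<^esub>, \<alpha>) = artin_incl S m \<alpha>)
    \<and> (\<forall>u\<in>Upsilon_hat S m.
         natural_hom S m (Omega_hat_gen S m u, \<one>\<^bsub>artin_group S m\<^esub>) = u)"
proof (intro conjI ballI)
  interpret A: group "artin_group S m" by (rule artin_group_group)
  show "natural_hom S m \<in> iso
      (semidirect_product (Omega_hat_monoid S m) (artin_group S m) (conj_action S m))
      (singular_artin_monoid S m)"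
    by (rule natural_hom_iso)
  show "natural_hom S m (\<one>\<^bsub>Omega_hat_monoid S m\<^esub>, \<one>\<^bsub>artin_group S m\<^esub>)
      = \<one>\<^bsub>singular_artin_monoid S m\<^esub>"
    by (simp add: natural_hom_unit artin_incl_one)
  show "natural_hom S m (\<one>\<^bsub>Omega_hat_monoid S m\<^esub>, \<alpha>) = artin_incl S m \<alpha>"
    if "\<alpha> \<in> carrier (artin_group S m)" for \<alpha>
    using that by (rule natural_hom_unit)
  show "natural_hom S m (Omega_hat_gen S m u, \<one>\<^bsub>artin_group S m\<^esub>) = u"
    if "u \<in> Upsilon_hat S m" for u
    using that by (simp add: natural_hom_graph Omega_hat_gen_closed vertex_lift_gen)
qed

end
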